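(* Let $R$ be a ring (unital and associative, not necessarily commutative). Let $n$ be a positive integer and $p\in\mathbb{N}$. Let $h_{k,\,i}$ be an element of $R$ for all $k\in\mathbb{Z}$ and $i\in[n]$. For any $\alpha\in\mathbb{Z}^n$, define $$t_\alpha:=\operatorname{rowdet}\left(\left(h_{\alpha_i+j,\,i}\right)_{i,j\in[n]}\right)\in R.$$ Let $\eta$ be the $n$-tuple $$(1,2,\ldots,n)+(\underbrace{0,0,\ldots,0}_{n-1\text{ zeroes}},p)=(1,2,\ldots,n-1,n+p)\in\mathbb{Z}^n.$$ Let $\alpha\in\mathbb{Z}^n$. Then $$\sum_{\substack{\beta\in\mathbb{N}^n;\\ |\beta|=p}}t_{\alpha+\beta}=\operatorname{rowdet}\left(\left(h_{\alpha_i+\eta_j,\,i}\right)_{i,j\in[n]}\right).$$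
   Context: $\mathbb{N}=\{0,1,2,\ldots\}$ and $[n]=\{1,2,\ldots,n\}$. For an $n$-tuple $\alpha$, $\alpha_i$ denotes its $i$-th entry, and for $\alpha\in\mathbb{Z}^n$ we set $|\alpha|:=\alpha_1+\alpha_2+\cdots+\alpha_n$. Addition of $n$-tuples is entrywise. $S_n$ is the group of permutations of $[n]$, and $(-1)^\sigma$ is the sign of $\sigma\in S_n$. For an $n\times n$-matrix $A=(a_{i,j})_{i,j\in[n]}$ over $R$ (whose $(i,j)$-th entry is $a_{i,j}$), the row-determinant is $$\operatorname{rowdet}A:=\sum_{\sigma\in S_n}(-1)^\sigma a_{1,\sigma(1)}a_{2,\sigma(2)}\cdots a_{n,\sigma(n)}\in R$$ (factors multiplied in this order). *)

theory Defs
  imports "HOL-Combinatorics.Permutations" "HOL-Library.FuncSet"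
begin

text \<open>
  The class \<open>ring_1\<close> requires \<open>0 \<noteq> 1\<close>; the sort \<open>{ring, monoid_mult}\<close> describes
  arbitrary unital associative rings, the zero ring included.  Since \<open>of_int\<close> is not
  available there, the sign of a permutation is written as a case distinction.

  An \<open>n\<close>-tuple is a function on \<open>nat\<close> of which only the values on \<open>{1..n}\<close> matter; likewise
  for the indices of matrices.
\<close>

definition rowdet :: "nat \<Rightarrow> (nat \<Rightarrow> nat \<Rightarrow> 'a::{ring, monoid_mult}) \<Rightarrow> 'a" where
  "rowdet n A = (\<Sum>\<sigma> | \<sigma> permutes {1..n}.
     (if evenperm \<sigma> then 1 else - 1) * prod_list (map (\<lambda>i. A i (\<sigma> i)) [1..<Suc n]))"

definition t :: "nat \<Rightarrow> (int \<Rightarrow> nat \<Rightarrow> 'a::{ring, monoid_mult}) \<Rightarrow> (nat \<Rightarrow> int) \<Rightarrow> 'a" where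
  "t n h \<alpha> = rowdet n (\<lambda>i j. h (\<alpha> i + int j) i)"

definition eta :: "nat \<Rightarrow> nat \<Rightarrow> nat \<Rightarrow> int" where
  "eta n p j = int j + (if j = n then int p else 0)"

text \<open>
  Tuples in \<open>\<nat>\<^sup>n\<close> of size \<open>p\<close>.  Being extensional on \<open>{1..n}\<close>, each tuple is
  represented by exactly one function.
\<close>

definition nat_tuples :: "nat \<Rightarrow> nat \<Rightarrow> (nat \<Rightarrow> nat) set" where
  "nat_tuples n p = {\<beta> \<in> {1..n} \<rightarrow>\<^sub>E UNIV. (\<Sum>i = 1..n. \<beta> i) = p}"

lemma finite_nat_tuples: "finite (nat_tuples n p)"
proof (rule finite_subset)
  show "nat_tuples n p \<subseteq> {1..n} \<rightarrow>\<^sub>E {..p}"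
  proof
    fix \<beta> assume "\<beta> \<in> nat_tuples n p"
    then have "\<beta> \<in> {1..n} \<rightarrow>\<^sub>E UNIV" and p: "(\<Sum>i = 1..n. \<beta> i) = p"
      by (auto simp: nat_tuples_def)
    moreover have "\<beta> i \<le> p" if "i \<in> {1..n}" for i
      using member_le_sum[of i "{1..n}" \<beta>] that p by simp
    ultimately show "\<beta> \<in> {1..n} \<rightarrow>\<^sub>E {..p}"
      by (auto simp: PiE_iff)
  qed
  show "finite ({1..n} \<rightarrow>\<^sub>E {..p})"
    by (intro finite_PiE) auto
qed

end

(*
  Expanding both sides, each term of the left side is a signed product of the h (\<alpha> i + \<gamma> i) i
  with \<gamma> = \<beta> + \<sigma>, so the coefficient of the product belonging to \<gamma> is the signed number of
  the permutations \<sigma> \<le> \<gamma>. Only the truncation i \<mapsto> min (\<gamma> i) n matters for the condition \<sigma> \<le> \<gamma>.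
  If it takes a value twice, transposing the two positions cancels all \<sigma>; if it is a
  permutation \<tau>, then \<sigma> = \<tau> is the only possibility, and |\<gamma>| = p + (1 + ... + n) forces
  \<gamma> = \<eta> \<circ> \<tau>.
*)

theory Submission imports Defs begin

text \<open>Right multiplication by a transposition is an involution of \<open>S\<close> that flips
  the sign. It pairs even with odd elements, so the argument needs no division by 2.\<close>

lemma sum_sign_closed_under_transpose_eq_0:
  fixes x :: "'a::ab_group_add"
  assumes "finite S" "a \<noteq> b"
    and perm: "\<And>\<sigma>. \<sigma> \<in> S \<Longrightarrow> permutation \<sigma>"
    and closed: "\<And>\<sigma>. \<sigma> \<in> S \<Longrightarrow> \<sigma> \<circ> transpose a b \<in> S"
  shows "(\<Sum>\<sigma>\<in>S. if evenperm \<sigma> then x else - x) = 0"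
proof -
  have flip: "evenperm (\<sigma> \<circ> transpose a b) \<longleftrightarrow> \<not> evenperm \<sigma>" if "\<sigma> \<in> S" for \<sigma>
    using that assms(2) by (simp add: evenperm_comp perm permutation_swap_id evenperm_swap)
  have "(\<Sum>\<sigma>\<in>{\<sigma>\<in>S. \<not> evenperm \<sigma>}. - x) = (\<Sum>\<sigma>\<in>{\<sigma>\<in>S. evenperm \<sigma>}. - x)"
    by (rule sum.reindex_bij_witness[where i = "\<lambda>\<sigma>. \<sigma> \<circ> transpose a b"
          and j = "\<lambda>\<sigma>. \<sigma> \<circ> transpose a b"])
      (auto simp: flip closed comp_assoc)
  with \<open>finite S\<close> show ?thesis
    by (simp add: sum.If_cases Int_def sum_negf)
qed

text \<open>Both permutations have the same sum over \<open>A\<close>, so none of the inequalities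
  can be strict.\<close>

lemma permutes_le_imp_eq:
  fixes \<sigma> \<tau> :: "nat \<Rightarrow> nat"
  assumes "finite A" "\<sigma> permutes A" "\<tau> permutes A" "\<And>i. i \<in> A \<Longrightarrow> \<sigma> i \<le> \<tau> i"
  shows "\<sigma> = \<tau>"
proof -
  have sums: "sum \<sigma> A = sum \<tau> A"
    using sum.permute[OF assms(2), of "\<lambda>i. i"] sum.permute[OF assms(3), of "\<lambda>i. i"]
    by (simp add: o_def)
  have "\<sigma> i = \<tau> i" if "i \<in> A" for i
    using sum_mono_inv[OF sums assms(4) that assms(1)] .
  then show ?thesis
    using assms(2,3) by (metis ext permutes_not_in)
qed

text \<open>The tuples \<gamma> = \<beta> + \<sigma> have natural entries and are compared with
  \<eta> before any embedding into the integers.\<close>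

definition eta_nat :: "nat \<Rightarrow> nat \<Rightarrow> nat \<Rightarrow> nat" where
  "eta_nat n p j = j + (if j = n then p else 0)"

lemma int_eta_nat: "int (eta_nat n p j) = eta n p j"
  by (simp add: eta_nat_def eta_def)

lemma sum_eta_nat:
  assumes "n > 0"
  shows "(\<Sum>i=1..n. eta_nat n p i) = p + (\<Sum>i=1..n. i)"
  using assms by (simp add: eta_nat_def sum.distrib sum.delta)

lemma sum_eta_nat_permutes:
  assumes "n > 0" "\<tau> permutes {1..n}"
  shows "(\<Sum>i=1..n. eta_nat n p (\<tau> i)) = p + (\<Sum>i=1..n. i)"
  using sum.permute[OF assms(2), of "eta_nat n p"] sum_eta_nat[OF assms(1)] by (simp add: o_def)

text \<open>The truncation is an injection of \<open>{1..n}\<close> into itself, hence a permutation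
  \<tau>. Truncating can only have changed the entry where \<tau> takes the value \<open>n\<close>,
  and the prescribed sum determines that entry.\<close>

lemma truncated_injective_imp_eta_nat:
  assumes "n > 0"
    and pos: "\<And>i. i \<in> {1..n} \<Longrightarrow> \<gamma> i > 0"
    and inj: "inj_on (\<lambda>i. min (\<gamma> i) n) {1..n}"
    and sum: "(\<Sum>i=1..n. \<gamma> i) = p + (\<Sum>i=1..n. i)"
  obtains \<tau> where "\<tau> permutes {1..n}" "\<And>i. i \<in> {1..n} \<Longrightarrow> \<gamma> i = eta_nat n p (\<tau> i)"
proof -
  define \<tau> where "\<tau> i = (if i \<in> {1..n} then min (\<gamma> i) n else i)" for i
  have "inj_on \<tau> {1..n}"
    using inj inj_on_cong[of "{1..n}" \<tau> "\<lambda>i. min (\<gamma> i) n"] by (simp add: \<tau>_def)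
  moreover have "\<tau> ` {1..n} \<subseteq> {1..n}"
    using pos \<open>n > 0\<close> by (auto simp: \<tau>_def Suc_le_eq)
  ultimately have "bij_betw \<tau> {1..n} {1..n}"
    by (simp add: bij_betw_def endo_inj_surj)
  then have perm: "\<tau> permutes {1..n}"
    by (rule bij_imp_permutes) (auto simp: \<tau>_def)
  have "n \<in> {1..n}"
    using \<open>n > 0\<close> by simp
  \<comment> \<open>All other positions have \<tau> i < n, so there the minimum is \<gamma> i
    itself.\<close>
  then obtain k where k: "k \<in> {1..n}" "\<tau> k = n"
    using permutes_image[OF perm] by (metis imageE)
  have eq: "\<gamma> i = eta_nat n p (\<tau> i)" if "i \<in> {1..n} - {k}" for i
  proof -
    have "\<tau> i \<noteq> n"
      using permutes_inj[OF perm] k that by (metis DiffE injD insertI1)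
    then show ?thesis
      using that by (auto simp: \<tau>_def eta_nat_def min_def split: if_splits)
  qed
  \<comment> \<open>Equal totals that agree off \<open>k\<close> must agree at
    \<open>k\<close>.\<close>
  have "(\<Sum>i=1..n. \<gamma> i) = (\<Sum>i=1..n. eta_nat n p (\<tau> i))"
    using sum sum_eta_nat_permutes[OF \<open>n > 0\<close> perm] by simp
  then have "\<gamma> k + (\<Sum>i\<in>{1..n}-{k}. \<gamma> i)
      = eta_nat n p (\<tau> k) + (\<Sum>i\<in>{1..n}-{k}. eta_nat n p (\<tau> i))"
    using k by (simp add: sum.remove)
  then have "\<gamma> k = eta_nat n p (\<tau> k)"
    using eq by simp
  with eq perm show thesis
    by (intro that[of \<tau>]) (metis DiffI singletonD)+
qed

text \<open>These are the \<sigma> that can occur in a decomposition \<gamma> = \<beta> + \<sigma>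
  with \<beta> having natural entries.\<close>

definition perms_below :: "nat \<Rightarrow> (nat \<Rightarrow> nat) \<Rightarrow> (nat \<Rightarrow> nat) set" where
  "perms_below n \<gamma> = {\<sigma>. \<sigma> permutes {1..n} \<and> (\<forall>i\<in>{1..n}. \<sigma> i \<le> \<gamma> i)}"

lemma finite_perms_below: "finite (perms_below n \<gamma>)"
  by (rule finite_subset[OF _ finite_permutations[of "{1..n}"]]) (auto simp: perms_below_def)

text \<open>A permutation below \<eta> \<circ> \<tau> is already below \<tau>: the two bounds differ
  only where \<tau> i = n, and there \<sigma> i \<le> n holds anyway.\<close>

lemma perms_below_eta_nat:
  assumes "\<tau> permutes {1..n}" "\<And>i. i \<in> {1..n} \<Longrightarrow> \<gamma> i = eta_nat n p (\<tau> i)"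
  shows "perms_below n \<gamma> = {\<tau>}"
proof -
  have "\<sigma> = \<tau>" if "\<sigma> \<in> perms_below n \<gamma>" for \<sigma>
  proof (rule permutes_le_imp_eq[of "{1..n}"])
    fix i assume i: "i \<in> {1..n}"
    then have "\<sigma> i \<in> {1..n}" "\<sigma> i \<le> eta_nat n p (\<tau> i)"
      using that assms(2) permutes_in_image[of \<sigma> "{1..n}" i] by (auto simp: perms_below_def)
    then show "\<sigma> i \<le> \<tau> i"
      by (auto simp: eta_nat_def split: if_splits)
  qed (use that assms(1) in \<open>auto simp: perms_below_def\<close>)
  moreover have "\<tau> \<in> perms_below n \<gamma>"
    using assms by (auto simp: perms_below_def eta_nat_def)
  ultimately show ?thesis
    by blast
qed

text \<open>As \<sigma> i \<le> n, the bounds \<gamma> i and \<open>min (\<gamma> i) n\<close> are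
  equivalent. Two positions with the same truncated bound can therefore exchange their
  values.\<close>

lemma sum_sign_perms_below_eq_0:
  fixes x :: "'a::ab_group_add"
  assumes "\<not> inj_on (\<lambda>i. min (\<gamma> i) n) {1..n}"
  shows "(\<Sum>\<sigma>\<in>perms_below n \<gamma>. if evenperm \<sigma> then x else - x) = 0"
proof -
  from assms obtain a b where ab: "a \<in> {1..n}" "b \<in> {1..n}" "a \<noteq> b" "min (\<gamma> a) n = min (\<gamma> b) n"
    by (auto simp: inj_on_def)
  show ?thesis
  proof (rule sum_sign_closed_under_transpose_eq_0[OF finite_perms_below \<open>a \<noteq> b\<close>])
    fix \<sigma> assume "\<sigma> \<in> perms_below n \<gamma>"
    then have \<sigma>: "\<sigma> permutes {1..n}" and le: "\<And>i. i \<in> {1..n} \<Longrightarrow> \<sigma> i \<le> \<gamma> i"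
      by (auto simp: perms_below_def)
    show "permutation \<sigma>"
      using \<sigma> by (auto simp: permutation_permutes)
    have le': "\<sigma> i \<le> min (\<gamma> i) n" if "i \<in> {1..n}" for i
      using that le[OF that] permutes_in_image[OF \<sigma>, of i] by auto
    \<comment> \<open>At \<open>a\<close> the new value is \<sigma> b, which is at most
      \<open>min (\<gamma> b) n = min (\<gamma> a) n\<close>; likewise at \<open>b\<close>.\<close>
    have "\<sigma> (transpose a b i) \<le> \<gamma> i" if "i \<in> {1..n}" for i
      using le'[OF ab(1)] le'[OF ab(2)] le[OF that] ab(4) by (auto simp: transpose_def)
    then show "\<sigma> \<circ> transpose a b \<in> perms_below n \<gamma>"
      using permutes_compose[OF permutes_swap_id[OF ab(1,2)] \<sigma>] by (auto simp: perms_below_def)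
  qed
qed

text \<open>The substitution (\<beta>, \<sigma>) \<mapsto> (\<beta> + \<sigma>, \<sigma>) is a
  bijection, and every \<sigma> raises the size by 1 + ... + n.\<close>

lemma sum_nat_tuples_add_permutation:
  fixes f :: "(nat \<Rightarrow> nat) \<Rightarrow> (nat \<Rightarrow> nat) \<Rightarrow> 'a::comm_monoid_add"
  shows "(\<Sum>\<beta>\<in>nat_tuples n p. \<Sum>\<sigma> | \<sigma> permutes {1..n}. f \<sigma> (\<lambda>i\<in>{1..n}. \<beta> i + \<sigma> i))
       = (\<Sum>\<gamma>\<in>nat_tuples n (p + (\<Sum>i=1..n. i)). \<Sum>\<sigma>\<in>perms_below n \<gamma>. f \<sigma> \<gamma>)"
proof -
  have perm_sum: "(\<Sum>i=1..n. \<sigma> i) = (\<Sum>i=1..n. i)" if "\<sigma> permutes {1..n}" for \<sigma>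
    using sum.permute[OF that, of "\<lambda>i. i"] by (simp add: o_def)
  have add: "(\<lambda>i\<in>{1..n}. \<beta> i + \<sigma> i) \<in> nat_tuples n (p + (\<Sum>i=1..n. i))"
    if "\<beta> \<in> nat_tuples n p" "\<sigma> permutes {1..n}" for \<beta> \<sigma>
    using that perm_sum[OF that(2)] by (auto simp: nat_tuples_def sum.distrib)
  \<comment> \<open>Subtraction of naturals is exact here because \<sigma> \<le> \<gamma> on
    \<open>{1..n}\<close>.\<close>
  have diff: "(\<lambda>i\<in>{1..n}. \<gamma> i - \<sigma> i) \<in> nat_tuples n p"
    if "\<gamma> \<in> nat_tuples n (p + (\<Sum>i=1..n. i))" "\<sigma> \<in> perms_below n \<gamma>" for \<gamma> \<sigma>
    using that perm_sum[of \<sigma>]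
      sum_subtractf_nat[of "{1..n}" \<sigma> \<gamma>]
    by (auto simp: nat_tuples_def perms_below_def)
  have "(\<Sum>\<beta>\<in>nat_tuples n p. \<Sum>\<sigma> | \<sigma> permutes {1..n}. f \<sigma> (\<lambda>i\<in>{1..n}. \<beta> i + \<sigma> i))
      = (\<Sum>(\<beta>, \<sigma>)\<in>nat_tuples n p \<times> {\<sigma>. \<sigma> permutes {1..n}}. f \<sigma> (\<lambda>i\<in>{1..n}. \<beta> i + \<sigma> i))"
    by (rule sum.cartesian_product)
  also have "\<dots> = (\<Sum>(\<gamma>, \<sigma>)\<in>Sigma (nat_tuples n (p + (\<Sum>i=1..n. i))) (perms_below n). f \<sigma> \<gamma>)"
  \<comment> \<open>Both witnesses restrict to \<open>{1..n}\<close> because members of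
    \<open>nat_tuples\<close> are extensional.\<close>
  proof (rule sum.reindex_bij_witness[where
        i = "\<lambda>(\<gamma>, \<sigma>). (\<lambda>i\<in>{1..n}. \<gamma> i - \<sigma> i, \<sigma>)" and j = "\<lambda>(\<beta>, \<sigma>). (\<lambda>i\<in>{1..n}. \<beta> i + \<sigma> i, \<sigma>)"],
      goal_cases)
    case (1 a)
    then show ?case
      by (auto simp: nat_tuples_def PiE_iff extensional_def fun_eq_iff)
  next
    case (2 a)
    then show ?case
      using add by (auto simp: perms_below_def)
  next
    case (3 b)
    then show ?case
      by (auto simp: nat_tuples_def perms_below_def PiE_iff extensional_def fun_eq_iff)
  next
    case (4 b)
    then show ?case
      using diff by (auto simp: perms_below_def)
  qed auto
  also have "\<dots> = (\<Sum>\<gamma>\<in>nat_tuples n (p + (\<Sum>i=1..n. i)). \<Sum>\<sigma>\<in>perms_below n \<gamma>. f \<sigma> \<gamma>)"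
    by (rule sum.Sigma[symmetric]) (simp_all add: finite_nat_tuples finite_perms_below)
  finally show ?thesis .
qed

text \<open>Only the tuples \<eta> \<circ> \<tau> survive, each with the single sign of \<tau>; the
  outer sum is then reindexed by \<tau>.\<close>

lemma sum_sign_perms_below_nat_tuples:
  fixes P :: "(nat \<Rightarrow> nat) \<Rightarrow> 'a::ab_group_add"
  assumes "n > 0"
  shows "(\<Sum>\<gamma>\<in>nat_tuples n (p + (\<Sum>i=1..n. i)).
            \<Sum>\<sigma>\<in>perms_below n \<gamma>. if evenperm \<sigma> then P \<gamma> else - P \<gamma>)
       = (\<Sum>\<tau> | \<tau> permutes {1..n}.
            if evenperm \<tau> then P (\<lambda>i\<in>{1..n}. eta_nat n p (\<tau> i))
            else - P (\<lambda>i\<in>{1..n}. eta_nat n p (\<tau> i)))"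
    (is "(\<Sum>\<gamma>\<in>?T. ?C \<gamma>) = ?R")
proof -
  define E where "E \<tau> = (\<lambda>i\<in>{1..n}. eta_nat n p (\<tau> i))" for \<tau>
  let ?S = "{\<tau>. \<tau> permutes {1..n}}"
  have below: "perms_below n (E \<tau>) = {\<tau>}" if "\<tau> \<in> ?S" for \<tau>
    using that by (intro perms_below_eta_nat[where p = p]) (auto simp: E_def)
  \<comment> \<open>The permutation \<tau> is recovered from \<open>E \<tau>\<close> as the only
    element below it.\<close>
  have inj: "inj_on E ?S"
    by (rule inj_on_inverseI[where g = "\<lambda>\<gamma>. the_elem (perms_below n \<gamma>)"]) (simp only: below the_elem_eq)
  have "E ` ?S \<subseteq> ?T"
    using sum_eta_nat_permutes[OF assms] by (auto simp: E_def nat_tuples_def)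
  moreover have "?C \<gamma> = 0" if "\<gamma> \<in> ?T - E ` ?S" for \<gamma>
  \<comment> \<open>Positivity is what makes the truncation map into \<open>{1..n}\<close>. With a
    zero entry there is no permutation below \<gamma> at all, since \<sigma> i \<ge> 1.\<close>
  proof (cases "\<forall>i\<in>{1..n}. \<gamma> i > 0")
    case pos: True
    have "\<not> inj_on (\<lambda>i. min (\<gamma> i) n) {1..n}"
    proof
      assume "inj_on (\<lambda>i. min (\<gamma> i) n) {1..n}"
      moreover have "(\<Sum>i=1..n. \<gamma> i) = p + (\<Sum>i=1..n. i)"
        using that by (simp add: nat_tuples_def)
      ultimately obtain \<tau>
        where \<tau>: "\<tau> permutes {1..n}" "\<And>i. i \<in> {1..n} \<Longrightarrow> \<gamma> i = eta_nat n p (\<tau> i)"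
        using truncated_injective_imp_eta_nat[OF assms, of \<gamma> p] pos by metis
      have "\<gamma> = E \<tau>"
        using that \<tau>(2) by (auto simp: E_def nat_tuples_def PiE_iff extensional_def fun_eq_iff)
      with \<tau>(1) that show False
        by blast
    qed
    then show ?thesis
      by (rule sum_sign_perms_below_eq_0)
  next
    case False
    then obtain i where i: "i \<in> {1..n}" "\<gamma> i = 0"
      by auto
    have "\<sigma> \<notin> perms_below n \<gamma>" for \<sigma>
      using i permutes_in_image[of \<sigma> "{1..n}" i] by (force simp: perms_below_def)
    then have "perms_below n \<gamma> = {}"
      by blast
    then show ?thesis
      by simp
  qed
  ultimately have "(\<Sum>\<gamma>\<in>?T. ?C \<gamma>) = (\<Sum>\<gamma>\<in>E ` ?S. ?C \<gamma>)"
    by (intro sum.mono_neutral_right finite_nat_tuples) auto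
  also have "\<dots> = (\<Sum>\<tau>\<in>?S. ?C (E \<tau>))"
    by (rule sum.reindex[OF inj, unfolded o_def])
  also have "\<dots> = ?R"
    unfolding E_def[symmetric] by (rule sum.cong) (simp_all add: below)
  finally show ?thesis .
qed

theorem theorem2p1:
  fixes h :: "int \<Rightarrow> nat \<Rightarrow> 'a::{ring, monoid_mult}"
    and n p :: nat
    and \<alpha> :: "nat \<Rightarrow> int"
  assumes "n > 0"
  shows "(\<Sum>\<beta>\<in>nat_tuples n p. t n h (\<lambda>i. \<alpha> i + int (\<beta> i)))
       = rowdet n (\<lambda>i j. h (\<alpha> i + eta n p j) i)"
proof -
  \<comment> \<open>The factors are ordered by the row index \<open>i\<close>, whatever \<sigma> is,
    so equal \<gamma> give equal products without commutativity.\<close>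
  define P where "P \<gamma> = prod_list (map (\<lambda>i. h (\<alpha> i + int (\<gamma> i)) i) [1..<Suc n])" for \<gamma>
  have P_restrict: "P (restrict g {1..n}) = P g" for g
    unfolding P_def by (intro arg_cong[where f = prod_list] map_cong) auto
  \<comment> \<open>The general \<open>g\<close> serves both sides:
    \<open>g i j = \<beta> i + j\<close> gives the summands on the left,
    \<open>g i j = eta_nat n p j\<close> the determinant on the right.\<close>
  have rowdet: "rowdet n (\<lambda>i j. h (\<alpha> i + int (g i j)) i)
      = (\<Sum>\<sigma> | \<sigma> permutes {1..n}. if evenperm \<sigma> then P (\<lambda>i\<in>{1..n}. g i (\<sigma> i))
          else - P (\<lambda>i\<in>{1..n}. g i (\<sigma> i)))" for g
    unfolding rowdet_def P_restrict by (rule sum.cong) (auto simp: P_def)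
  have "(\<Sum>\<beta>\<in>nat_tuples n p. t n h (\<lambda>i. \<alpha> i + int (\<beta> i)))
      = (\<Sum>\<beta>\<in>nat_tuples n p. \<Sum>\<sigma> | \<sigma> permutes {1..n}.
          if evenperm \<sigma> then P (\<lambda>i\<in>{1..n}. \<beta> i + \<sigma> i) else - P (\<lambda>i\<in>{1..n}. \<beta> i + \<sigma> i))"
    using rowdet[of "\<lambda>i j. \<beta> i + j" for \<beta>] by (simp add: t_def add.assoc)
  also have "\<dots> = rowdet n (\<lambda>i j. h (\<alpha> i + int (eta_nat n p j)) i)"
    unfolding sum_nat_tuples_add_permutation[where f = "\<lambda>\<sigma> \<gamma>. if evenperm \<sigma> then P \<gamma> else - P \<gamma>"]
      sum_sign_perms_below_nat_tuples[OF assms] rowdet ..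
  finally show ?thesis
    by (simp add: int_eta_nat)
qed

end
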